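(* Let $r, D, \Delta$ be integers with $r\geq 0$ and $\Delta\geq D \geq 2r+3$. Then the (vertex symmetric) digraph $\Gamma_\Delta(D,-r)$ is $(D+r)$-reachable.
   Context: For integers $\Delta\geq D\ge 1$ and $0\le r\le D-1$, the digraph $\Gamma_\Delta(D,-r)$ is defined as follows. Its vertices are the sequences $x_1x_2\cdots x_D$ of $D$ distinct letters from the alphabet $\{1,2,\ldots,\Delta+1\}$. There is an arc from $x_1x_2\cdots x_D$ to each of the following vertices, and to no others: (rotations) $x_k x_1\cdots x_{k-1}x_{k+1}\cdots x_D$ for each $k$ with $r+2\leq k\leq D$; (shifts) $y x_1x_2\cdots x_{D-1}$ for each $y\in\{1,\ldots,\Delta+1\}\setminus\{x_1,\ldots,x_D\}$. A digraph is said to be $k$-reachable if for any two vertices $u$ and $v$, not necessarily distinct, there exists a directed path from $u$ to $v$ of length exactly $k$, where repeated vertices and repeated arcs are allowed (i.e. a directed walk of length $k$). *)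

theory Defs
  imports "Graph_Theory.Graph_Theory"
begin

text \<open>
  Letters are natural numbers, and the word \<open>x\<^sub>1x\<^sub>2\<dots>x\<^sub>D\<close> is the list with \<open>x ! (i - 1) = x\<^sub>i\<close>:
  words are indexed from 1, lists from 0.
\<close>

definition rotation :: "nat \<Rightarrow> 'a list \<Rightarrow> 'a list" where
  "rotation k x = x ! (k - 1) # take (k - 1) x @ drop k x"

definition shift :: "'a \<Rightarrow> 'a list \<Rightarrow> 'a list" where
  "shift y x = y # butlast x"

definition Gamma_verts :: "nat \<Rightarrow> nat \<Rightarrow> nat list set" where
  "Gamma_verts \<Delta> D = {x. length x = D \<and> distinct x \<and> set x \<subseteq> {1..\<Delta> + 1}}"

text \<open>
  \<open>Gamma \<Delta> D r\<close> is \<open>\<Gamma>\<^sub>\<Delta>(D,-r)\<close>, meant for \<open>\<Delta> \<ge> D \<ge> 1\<close> and \<open>r \<le> D - 1\<close>; the parameter \<open>r\<close> is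
  the \<open>r\<close> of the notation \<open>-r\<close>, without the sign.
\<close>

definition Gamma :: "nat \<Rightarrow> nat \<Rightarrow> nat \<Rightarrow> nat list pair_pre_digraph" where
  "Gamma \<Delta> D r =
    \<lparr> pverts = Gamma_verts \<Delta> D,
      parcs =
        {(x, rotation k x) | x k. x \<in> Gamma_verts \<Delta> D \<and> r + 2 \<le> k \<and> k \<le> D} \<union>
        {(x, shift y x) | x y. x \<in> Gamma_verts \<Delta> D \<and> y \<in> {1..\<Delta> + 1} - set x} \<rparr>"

definition k_reachable :: "('a, 'b) pre_digraph \<Rightarrow> nat \<Rightarrow> bool" where
  "k_reachable G k \<longleftrightarrow>
    (\<forall>u \<in> verts G. \<forall>v \<in> verts G. \<exists>p. pre_digraph.awalk G u p v \<and> length p = k)"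

text \<open>
  Vertex symmetry means that the automorphisms act transitively on the vertices; an automorphism is
  an isomorphism onto the digraph itself.
\<close>

definition vertex_symmetric :: "('a, 'b) pre_digraph \<Rightarrow> bool" where
  "vertex_symmetric G \<longleftrightarrow>
    (\<forall>u \<in> verts G. \<forall>v \<in> verts G. \<exists>hom.
      pre_digraph.digraph_isomorphism G hom \<and> app_iso hom G = G \<and> iso_verts hom u = v)"

end

theory Submission
  imports Defs "HOL-Combinatorics.Permutations"
begin

text \<open>
  An arc prepends to the current word a letter that is not among its first \<open>r + 1\<close> letters; the
  old occurrence of that letter, or else the last letter, disappears. A walk from \<open>u\<close> is thus given
  by a word \<open>l\<close> such that in \<open>l @ u\<close> any \<open>r + 2\<close> consecutive letters starting in \<open>l\<close> are distinct.
  If the first letter of \<open>u\<close> differs from the last letter of \<open>v\<close>, take \<open>l = v @ w\<close> with \<open>w\<close> of length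
  \<open>r\<close>. If they agree, take \<open>l = butlast v @ w\<close> with \<open>w\<close> of length \<open>r + 1\<close> over the letters of
  \<open>butlast v\<close>: the last letter of \<open>v\<close> is then inherited from \<open>u\<close>. In both cases \<open>w\<close> can be chosen
  greedily.  Vertex symmetry comes from permuting the alphabet.
\<close>

section \<open>Vertex symmetry\<close>

text \<open>The permutation for the tails is corrected by swapping \<open>\<pi> a\<close> with
  \<open>b\<close>. By distinctness neither is the image of a tail letter, so the tail keeps its
  image.\<close>

lemma ex_permutes_map_eq:
  assumes "length u = length v" "distinct u" "distinct v" "set u \<subseteq> S" "set v \<subseteq> S"
  shows "\<exists>\<pi>. \<pi> permutes S \<and> map \<pi> u = v"
  using assms
proof (induction u v rule: list_induct2)
  case Nil
  then show ?case by (intro exI[of _ id] conjI permutes_id) simp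
next
  case (Cons a u b v)
  then obtain \<pi> where \<pi>: "\<pi> permutes S" "map \<pi> u = v" by auto
  let ?\<rho> = "transpose (\<pi> a) b \<circ> \<pi>"
  have "\<pi> a \<in> S" using \<pi>(1) Cons.prems by (simp add: permutes_in_image)
  then have "?\<rho> permutes S"
    using \<pi>(1) Cons.prems by (intro permutes_compose permutes_swap_id) auto
  moreover have "?\<rho> c = \<pi> c" if "c \<in> set u" for c
  proof -
    have "\<pi> c \<noteq> \<pi> a" using that Cons.prems permutes_inj[OF \<pi>(1)] by (auto dest: injD)
    moreover have "\<pi> c \<noteq> b" using that Cons.prems \<pi>(2) by auto
    ultimately show ?thesis by simp
  qed
  then have "map ?\<rho> (a # u) = b # v" using \<pi>(2) by auto
  ultimately show ?case by (intro exI[of _ ?\<rho>] conjI)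
qed

lemma Gamma_verts_rotation:
  assumes "x \<in> Gamma_verts \<Delta> D" "1 \<le> k" "k \<le> D"
  shows "rotation k x \<in> Gamma_verts \<Delta> D"
proof -
  obtain j where j: "k = Suc j" "j < length x" using assms by (cases k) (auto simp: Gamma_verts_def)
  have x: "x = take j x @ x ! j # drop (Suc j) x" using id_take_nth_drop[OF j(2)] .
  have "mset (rotation k x) = mset x"
    unfolding rotation_def j(1) by (subst (4) x) simp
  then have "length (rotation k x) = length x" "set (rotation k x) = set x"
      "distinct (rotation k x) = distinct x"
    by (auto dest: mset_eq_length mset_eq_setD mset_eq_imp_distinct_iff)
  then show ?thesis using assms by (auto simp: Gamma_verts_def)
qed

lemma Gamma_verts_shift:
  assumes "x \<in> Gamma_verts \<Delta> D" "y \<in> {1..\<Delta> + 1} - set x" "1 \<le> D"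
  shows "shift y x \<in> Gamma_verts \<Delta> D"
  using assms by (auto simp: Gamma_verts_def shift_def distinct_butlast dest: in_set_butlastD)

lemma wf_digraph_Gamma:
  assumes "1 \<le> D"
  shows "wf_digraph (with_proj (Gamma \<Delta> D r))"
  using assms by unfold_locales
    (auto simp: Gamma_def simp del: One_nat_def intro!: Gamma_verts_rotation Gamma_verts_shift)

lemma Gamma_verts_map:
  assumes "\<pi> permutes {1..\<Delta> + 1}" "x \<in> Gamma_verts \<Delta> D"
  shows "map \<pi> x \<in> Gamma_verts \<Delta> D"
  using assms permutes_inj[OF assms(1)] permutes_in_image[OF assms(1)]
  by (force simp: Gamma_verts_def distinct_map intro: inj_on_subset)

lemma rotation_map:
  assumes "1 \<le> k" "k \<le> length x"
  shows "rotation k (map f x) = map f (rotation k x)"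
  using assms by (simp add: rotation_def take_map drop_map)

lemma shift_map: "shift (f y) (map f x) = map f (shift y x)"
  by (simp add: shift_def map_butlast)

text \<open>Rotations depend only on positions, and an injective relabelling sends letters outside a
  word to letters outside its image.\<close>

lemma Gamma_arcs_map:
  assumes \<pi>: "\<pi> permutes {1..\<Delta> + 1}" and e: "e \<in> parcs (Gamma \<Delta> D r)"
  shows "map_prod (map \<pi>) (map \<pi>) e \<in> parcs (Gamma \<Delta> D r)"
proof -
  have "(\<exists>x k. e = (x, rotation k x) \<and> x \<in> Gamma_verts \<Delta> D \<and> r + 2 \<le> k \<and> k \<le> D) \<or>
      (\<exists>x y. e = (x, shift y x) \<and> x \<in> Gamma_verts \<Delta> D \<and> y \<in> {1..\<Delta> + 1} - set x)"
    using e by (auto simp: Gamma_def)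
  then show ?thesis
  proof (elim disjE exE conjE)
    fix x k assume *: "e = (x, rotation k x)" "x \<in> Gamma_verts \<Delta> D" "r + 2 \<le> k" "k \<le> D"
    then have "map_prod (map \<pi>) (map \<pi>) e = (map \<pi> x, rotation k (map \<pi> x))"
      by (simp add: rotation_map Gamma_verts_def)
    then show ?thesis using * Gamma_verts_map[OF \<pi>] by (auto simp: Gamma_def)
  next
    fix x y assume *: "e = (x, shift y x)" "x \<in> Gamma_verts \<Delta> D" "y \<in> {1..\<Delta> + 1} - set x"
    then have "map_prod (map \<pi>) (map \<pi>) e = (map \<pi> x, shift (\<pi> y) (map \<pi> x))"
      by (simp add: shift_map)
    moreover have "\<pi> y \<in> {1..\<Delta> + 1} - set (map \<pi> x)"
      using * permutes_in_image[OF \<pi>, of y] permutes_inj[OF \<pi>] by (auto dest: injD)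
    ultimately show ?thesis using * Gamma_verts_map[OF \<pi>] by (auto simp: Gamma_def)
  qed
qed

text \<open>Used with a permutation and its inverse acting on vertices and on arcs, to turn
  inclusion of the image into equality.\<close>

lemma image_eq_if_inverse_closed:
  assumes "\<And>x. x \<in> A \<Longrightarrow> f x \<in> A" "\<And>x. x \<in> A \<Longrightarrow> g x \<in> A" "\<And>x. f (g x) = x"
  shows "f ` A = A"
  using assms by (metis image_eqI image_subsetI subsetI subset_antisym)

lemma vertex_symmetric_Gamma:
  assumes "1 \<le> D"
  shows "vertex_symmetric (with_proj (Gamma \<Delta> D r))"
  unfolding vertex_symmetric_def
proof (intro ballI)
  let ?G = "with_proj (Gamma \<Delta> D r)"
  fix u v assume "u \<in> verts ?G" "v \<in> verts ?G"
  then have uv: "u \<in> Gamma_verts \<Delta> D" "v \<in> Gamma_verts \<Delta> D" by (auto simp: Gamma_def)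
  then obtain \<pi> where \<pi>: "\<pi> permutes {1..\<Delta> + 1}" and "map \<pi> u = v"
    using ex_permutes_map_eq[of u v "{1..\<Delta> + 1}"] by (auto simp: Gamma_verts_def)
  note inv = permutes_inv[OF \<pi>] and inv_o = permutes_inv_o(1)[OF \<pi>]
  let ?hom = "\<lparr>iso_verts = map \<pi>, iso_arcs = map_prod (map \<pi>) (map \<pi>),
    iso_head = snd, iso_tail = fst\<rparr> :: (nat list, nat list \<times> nat list, _, _) digraph_isomorphism"
  have "map \<pi> (map (inv \<pi>) x) = x" for x using inv_o by simp
  then have "map \<pi> ` Gamma_verts \<Delta> D = Gamma_verts \<Delta> D"
    and "map_prod (map \<pi>) (map \<pi>) ` parcs (Gamma \<Delta> D r) = parcs (Gamma \<Delta> D r)"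
    using Gamma_verts_map[OF \<pi>] Gamma_verts_map[OF inv] Gamma_arcs_map[OF \<pi>] Gamma_arcs_map[OF inv]
    by (intro image_eq_if_inverse_closed[where g = "map (inv \<pi>)"]
        image_eq_if_inverse_closed[where g = "map_prod (map (inv \<pi>)) (map (inv \<pi>))"];
        force)+
  then have "app_iso ?hom ?G = ?G"
    by (simp add: app_iso_def with_proj_def Gamma_def)
  moreover have "inj (map \<pi>)" using permutes_inj[OF \<pi>] by simp
  then have "pre_digraph.digraph_isomorphism ?G ?hom"
    using wf_digraph_Gamma[OF assms]
    by (auto simp: pre_digraph.digraph_isomorphism_def inj_on_subset prod.inj_map
        intro: inj_on_subset[OF _ subset_UNIV])
  ultimately show "\<exists>hom. pre_digraph.digraph_isomorphism ?G hom \<and> app_iso hom ?G = ?G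
      \<and> iso_verts hom u = v"
    using \<open>map \<pi> u = v\<close> by (intro exI[of _ ?hom]) simp
qed

section \<open>Walks as words\<close>

text \<open>Truncation to the old length treats both kinds of arc alike: for distinct
  \<open>x\<close>, nothing is cut if \<open>y\<close> occurs in \<open>x\<close>, and the last
  letter is cut if it does not.\<close>

definition move_front :: "'a \<Rightarrow> 'a list \<Rightarrow> 'a list" where
  "move_front y x = take (length x) (y # removeAll y x)"

lemma length_removeAll_distinct:
  assumes "distinct x"
  shows "length x \<le> Suc (length (removeAll y x))"
  using assms by (metis distinct_remove1_removeAll length_remove1 Suc_pred' diff_le_self le_SucI
      length_pos_if_in_set order_refl)

lemma length_move_front: "distinct x \<Longrightarrow> length (move_front y x) = length x"
  using length_removeAll_distinct[of x y] by (simp add: move_front_def)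

lemma distinct_move_front: "distinct x \<Longrightarrow> distinct (move_front y x)"
  by (cases x) (auto simp: move_front_def distinct_removeAll dest: in_set_takeD)

lemma foldr_move_front:
  assumes "distinct x"
  shows "distinct (foldr move_front l x) \<and> length (foldr move_front l x) = length x"
  using assms by (induction l) (auto simp: distinct_move_front length_move_front)

lemma move_front_arc:
  assumes x: "x \<in> Gamma_verts \<Delta> D" and y: "y \<in> {1..\<Delta> + 1}" "y \<notin> set (take (r + 1) x)"
    and D: "1 \<le> D"
  shows "(x, move_front y x) \<in> parcs (Gamma \<Delta> D r)"
proof (cases "y \<in> set x")
  case True
  then obtain j where j: "j < length x" "x ! j = y" by (auto simp: in_set_conv_nth)
  \<comment> \<open>Index \<open>j\<close> is word position \<open>Suc j\<close>, so avoiding the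
    first \<open>r + 1\<close> letters is the bound \<open>r + 2 \<le> k\<close> for the rotation
    with \<open>k = Suc j\<close>.\<close>
  have "\<not> j < r + 1" using y(2) j by (auto simp: in_set_conv_nth)
  have eq: "x = take j x @ y # drop (Suc j) x" using id_take_nth_drop[OF j(1)] j(2) by simp
  have "distinct x" using x by (simp add: Gamma_verts_def)
  then have "distinct (take j x @ y # drop (Suc j) x)" using eq by simp
  then have "removeAll y (take j x @ y # drop (Suc j) x) = take j x @ drop (Suc j) x"
    by (auto simp: removeAll_id)
  then have "move_front y x = rotation (Suc j) x"
    using j eq by (simp add: move_front_def rotation_def)
  then show ?thesis
    using x j \<open>\<not> j < r + 1\<close> by (auto simp: Gamma_def Gamma_verts_def intro!: exI[of _ "Suc j"])
next
  case False
  then have "move_front y x = shift y x"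
    using x D by (cases x rule: rev_cases) (auto simp: move_front_def shift_def Gamma_verts_def)
  then show ?thesis using False x y by (auto simp: Gamma_def)
qed

lemma take_move_front:
  assumes "y \<notin> set (take m x)" "Suc m \<le> length x"
  shows "take (Suc m) (move_front y x) = y # take m x"
proof -
  have "removeAll y x = removeAll y (take m x) @ removeAll y (drop m x)"
    by (metis append_take_drop_id removeAll_append)
  then show ?thesis using assms by (simp add: move_front_def min_def)
qed

text \<open>\<open>foldr\<close> consumes \<open>l\<close> from its right end, so what follows
  \<open>l ! i\<close> has been moved already. The next \<open>r + 1\<close> letters, possibly
  running into \<open>u\<close>, are those that \<open>l ! i\<close> must avoid.\<close>

definition spaced :: "nat \<Rightarrow> 'a list \<Rightarrow> 'a list \<Rightarrow> bool" where
  "spaced r l u \<longleftrightarrow> (\<forall>i < length l. l ! i \<notin> set (take (r + 1) (drop (Suc i) (l @ u))))"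

lemma spaced_Cons: "spaced r (y # l) u \<longleftrightarrow> y \<notin> set (take (r + 1) (l @ u)) \<and> spaced r l u"
  by (simp add: spaced_def All_less_Suc2)

lemma foldr_move_front_walk:
  fixes r :: nat
  assumes u: "u \<in> Gamma_verts \<Delta> D" and D: "r + 1 \<le> D" and l: "set l \<subseteq> {1..\<Delta> + 1}"
    and spaced: "spaced r l u"
  shows "\<exists>p. pre_digraph.awalk (with_proj (Gamma \<Delta> D r)) u p (foldr move_front l u)
    \<and> length p = length l"
proof -
  let ?G = "with_proj (Gamma \<Delta> D r)"
  interpret wf_digraph ?G using D by (intro wf_digraph_Gamma) simp
  \<comment> \<open>The induction also carries that the current vertex and \<open>l @ u\<close>
    share their first \<open>r + 1\<close> letters; this makes \<open>spaced\<close> the arc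
    condition.\<close>
  have "(\<exists>p. awalk u p (foldr move_front l u) \<and> length p = length l)
    \<and> take (r + 1) (foldr move_front l u) = take (r + 1) (l @ u)"
    using l spaced
  proof (induction l)
    case Nil
    have "u \<in> verts ?G" using u by (simp add: Gamma_def)
    then have "awalk u [] u" by (simp add: awalk_Nil_iff)
    then show ?case by auto
  next
    case (Cons y l)
    let ?s = "foldr move_front l u"
    obtain p where p: "awalk u p ?s" "length p = length l"
      and take: "take (r + 1) ?s = take (r + 1) (l @ u)"
      using Cons by (auto simp: spaced_Cons)
    have s: "?s \<in> Gamma_verts \<Delta> D" using awalk_last_in_verts[OF p(1)] by (simp add: Gamma_def)
    have y: "y \<notin> set (take (r + 1) ?s)" using Cons.prems(2) take by (simp add: spaced_Cons)
    then have arc: "(?s, move_front y ?s) \<in> arcs ?G"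
      using move_front_arc[OF s _ y] Cons.prems(1) D by simp
    have "awalk u (p @ [(?s, move_front y ?s)]) (move_front y ?s)"
      using arc_implies_awalk[OF arc] by (intro awalk_appendI[OF p(1)]) simp
    moreover have "take r ?s = take r (l @ u)"
      using arg_cong[OF take, of "take r"] by (simp add: min_def)
    moreover have "y \<notin> set (take r ?s)"
      using y set_take_subset_set_take[of r "r + 1" ?s] by auto
    then have "take (Suc r) (move_front y ?s) = y # take r ?s"
      using s D by (intro take_move_front) (auto simp: Gamma_verts_def)
    ultimately show ?case using p(2) by (auto intro!: exI[of _ "p @ _"])
  qed
  then show ?thesis by blast
qed

text \<open>As the letters of \<open>l\<close> are distinct, no move extracts an earlier one from
  the front block. Moves only delete letters from the rest of \<open>s\<close>, whose order
  survives.\<close>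

lemma foldr_move_front_distinct:
  assumes "distinct s" "distinct l"
  shows "foldr move_front l s = take (length s) (l @ filter (\<lambda>y. y \<notin> set l) s)"
  using assms(2)
proof (induction l)
  case Nil
  then show ?case by simp
next
  case (Cons y l)
  let ?n = "length s" and ?L = "l @ filter (\<lambda>y. y \<notin> set l) s"
  have L: "distinct ?L" using Cons.prems assms by auto
  have fold: "foldr move_front l s = take ?n ?L" using Cons by simp
  have "?n \<le> length ?L"
    using arg_cong[OF fold, of length] foldr_move_front[OF assms(1), of l] by simp
  have "?n \<le> Suc (length (removeAll y (take ?n ?L)))"
    using length_removeAll_distinct[of "take ?n ?L" y] L \<open>?n \<le> length ?L\<close> distinct_take[OF L, of ?n]
    by (simp add: min_absorb2)
  moreover have "removeAll y ?L = removeAll y (take ?n ?L) @ removeAll y (drop ?n ?L)"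
    by (metis append_take_drop_id removeAll_append)
  ultimately have "take ?n (y # removeAll y (take ?n ?L)) = take ?n (y # removeAll y ?L)"
    by (cases ?n) auto
  moreover have "removeAll y (filter (\<lambda>z. z \<notin> set l) s) = filter (\<lambda>z. z \<notin> set (y # l)) s"
    by (induction s) auto
  then have "removeAll y ?L = l @ filter (\<lambda>z. z \<notin> set (y # l)) s"
    using Cons.prems by simp
  moreover have "foldr move_front (y # l) s = take ?n (y # removeAll y (take ?n ?L))"
    using fold \<open>?n \<le> length ?L\<close>
    by (simp only: foldr.simps o_apply move_front_def length_take min_absorb2)
  ultimately show ?case by (simp only: append_Cons)
qed

section \<open>The intermediate letters\<close>

text \<open>Greedy choice: with fewer than \<open>n\<close> letters taken, a set of at least
  \<open>n\<close> still offers a new one. The bound \<open>n\<close> stays fixed while the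
  induction runs over the prefix length \<open>m\<close>.\<close>

lemma ex_distinct_representatives:
  assumes "\<And>i. i < n \<Longrightarrow> n \<le> card (A i)"
  shows "\<exists>w. length w = n \<and> distinct w \<and> (\<forall>i<n. w ! i \<in> A i)"
proof -
  have "\<exists>w. length w = m \<and> distinct w \<and> (\<forall>i<m. w ! i \<in> A i)" if "m \<le> n" for m
    using that
  proof (induction m)
    case 0
    then show ?case by simp
  next
    case (Suc m)
    then obtain w where w: "length w = m" "distinct w" "\<forall>i<m. w ! i \<in> A i" by auto
    have "card (set w) < card (A m)" using w(1,2) assms[of m] Suc.prems by (simp add: distinct_card)
    then have "\<not> A m \<subseteq> set w" using card_mono[of "set w" "A m"] by auto
    then obtain a where "a \<in> A m" "a \<notin> set w" by blast
    then show ?case using w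
      by (intro exI[of _ "w @ [a]"]) (auto simp: nth_append less_Suc_eq)
  qed
  then show ?thesis by blast
qed

text \<open>
  The hypothesis on \<open>n\<close> says that the letters of \<open>p\<close> and of \<open>u\<close> do not interfere: for \<open>n = r\<close> only
  the last letter of \<open>p\<close> and the first letter of \<open>u\<close> are close enough in \<open>p @ w @ u\<close>.
\<close>

lemma ex_intermediate_word:
  fixes r :: nat
  assumes p: "distinct p" "p \<noteq> []" and u: "distinct u" "u \<noteq> []"
    and n: "n = r + 1 \<or> n = r \<and> last p \<noteq> hd u"
    and A: "finite A" "hd u \<notin> A" "2 * r + 2 \<le> card A"
  shows "\<exists>w. length w = n \<and> distinct w \<and> set w \<subseteq> A \<and> spaced r (p @ w) u"
proof -
  \<comment> \<open>The letters of \<open>u\<close> and \<open>p\<close> within distance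
    \<open>r + 1\<close> of \<open>w ! i\<close>, which has index \<open>length p + i\<close> in
    \<open>p @ w @ u\<close>: after it come \<open>n - 1 - i\<close> letters of \<open>w\<close>,
    then \<open>r + 2 + i - n\<close> of \<open>u\<close>.\<close>
  let ?U = "\<lambda>i. set (take (r + 2 + i - n) u)"
  let ?P = "\<lambda>i. set (drop (length p + i - (r + 1)) p)"
  \<comment> \<open>Since \<open>hd u\<close> is not in \<open>A\<close>, \<open>u\<close> forbids
    at most \<open>r + 1 + i - n\<close> letters, and \<open>p\<close> at most
    \<open>r + 1 - i\<close>. Together these are \<open>2 * r + 2 - n\<close>, leaving at least
    \<open>n\<close>.\<close>
  have "n \<le> card (A - ?U i - ?P i)" if "i < n" for i
  proof -
    have U: "A - ?U i = A - set (take (r + 1 + i - n) (tl u))"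
      using u(2) A(2) n by (cases u) (auto simp: take_Cons' Suc_diff_le)
    have "card (set (take (r + 1 + i - n) (tl u))) \<le> r + 1 + i - n"
      by (rule order_trans[OF card_length]) simp
    moreover have "card (?P i) \<le> r + 1 - i"
      by (rule order_trans[OF card_length]) simp
    moreover have "card A - card (set (take (r + 1 + i - n) (tl u))) \<le> card (A - ?U i)"
      unfolding U by (rule diff_card_le_card_Diff) simp
    moreover have "card (A - ?U i) - card (?P i) \<le> card (A - ?U i - ?P i)"
      by (rule diff_card_le_card_Diff) simp
    ultimately show ?thesis using that n A(3) by linarith
  qed
  from ex_distinct_representatives[where A = "\<lambda>i. A - ?U i - ?P i", OF this] obtain w
    where w: "length w = n" "distinct w" "\<forall>i<n. w ! i \<in> A - ?U i - ?P i" by blast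
  have "(p @ w) ! i \<notin> set (take (r + 1) (drop (Suc i) ((p @ w) @ u)))"
    if i: "i < length (p @ w)" for i
  proof
    assume "(p @ w) ! i \<in> set (take (r + 1) (drop (Suc i) ((p @ w) @ u)))"
    then obtain d where d: "d < length (take (r + 1) (drop (Suc i) ((p @ w) @ u)))"
      and nth: "take (r + 1) (drop (Suc i) ((p @ w) @ u)) ! d = (p @ w) ! i"
      by (metis in_set_conv_nth)
    have d: "d < r + 1" "Suc i + d < length ((p @ w) @ u)"
      using d unfolding length_take length_drop by linarith+
    then have eq: "((p @ w) @ u) ! (Suc i + d) = (p @ w) ! i"
      using nth nth_drop[of "Suc i" "(p @ w) @ u" d] by (simp del: append_assoc drop_append)
    define j where "j = Suc i + d"
    have j: "i < j" "j \<le> i + r + 1" "j < length p + n + length u"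
      using d w(1) by (auto simp: j_def)
    have eq: "((p @ w) @ u) ! j = (p @ w) ! i" using eq by (simp add: j_def)
    \<comment> \<open>The cases locate the two equal letters. Distinctness settles \<open>pp\<close>
      and \<open>ww\<close>, the sets \<open>?P\<close> and \<open>?U\<close> settle
      \<open>pw\<close> and \<open>wu\<close>, and the hypothesis on \<open>n\<close> settles
      \<open>pu\<close>.\<close>
    consider (pp) "j < length p" | (pw) "i < length p" "length p \<le> j" "j < length p + n"
      | (pu) "i < length p" "length p + n \<le> j"
      | (ww) "length p \<le> i" "j < length p + n" | (wu) "length p \<le> i" "length p + n \<le> j"
      by linarith
    then show False
    proof cases
      case pp
      then show False using eq j p(1) by (auto simp: nth_append nth_eq_iff_index_eq)
    next
      case pw
      then have "j - length p < n" by linarith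
      then have "w ! (j - length p) = p ! i" using pw eq w(1) by (simp add: nth_append)
      moreover have "p ! i \<in> ?P (j - length p)"
        unfolding in_set_conv_nth using pw j
        by (intro exI[of _ "i - (length p + (j - length p) - (r + 1))"]) auto
      ultimately show False using w(3) \<open>j - length p < n\<close> by (metis DiffD2)
    next
      case pu
      then have "j = length p + n" "i = length p - 1" "n = r" using j n by auto
      then have "hd u = last p" using eq pu w(1) u(2) p(2)
        by (simp add: nth_append hd_conv_nth last_conv_nth)
      then show False using n \<open>n = r\<close> by simp
    next
      case ww
      then have lt: "j - length p < n" "i - length p < n" "j - length p \<noteq> i - length p"
        using j by linarith+
      then have "w ! (j - length p) = w ! (i - length p)"
        using ww eq w(1) j by (simp add: nth_append)
      then show False using lt w(1,2) by (simp add: nth_eq_iff_index_eq)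
    next
      case wu
      then have "\<not> j - length p < n" by linarith
      then have "u ! (j - length p - n) = w ! (i - length p)"
        using wu eq w(1) i by (simp add: nth_append)
      moreover have "i - length p < n" using wu i w(1) by simp
      moreover have "u ! (j - length p - n) \<in> ?U (i - length p)"
        unfolding in_set_conv_nth using wu j i w(1)
        by (intro exI[of _ "j - length p - n"]) auto
      ultimately show False using w(3) by (metis DiffD1 DiffD2)
    qed
  qed
  moreover have "set w \<subseteq> A" using w by (auto simp: in_set_conv_nth)
  ultimately show ?thesis using w unfolding spaced_def by blast
qed

section \<open>Reachability in exactly \<open>D + r\<close> steps\<close>

lemma k_reachable_Gamma:
  assumes "\<Delta> \<ge> D" and D: "D \<ge> 2 * r + 3"
  shows "k_reachable (with_proj (Gamma \<Delta> D r)) (D + r)"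
  unfolding k_reachable_def
proof (intro ballI)
  let ?G = "with_proj (Gamma \<Delta> D r)"
  fix u v assume "u \<in> verts ?G" "v \<in> verts ?G"
  then have u: "u \<in> Gamma_verts \<Delta> D" and v: "v \<in> Gamma_verts \<Delta> D" by (auto simp: Gamma_def)
  then have lens: "length u = D" "length v = D" and dist: "distinct u" "distinct v"
    and sub: "set u \<subseteq> {1..\<Delta> + 1}" "set v \<subseteq> {1..\<Delta> + 1}"
    by (auto simp: Gamma_verts_def)
  have ne: "u \<noteq> []" "v \<noteq> []" using lens D by auto
  have "\<exists>l. length l = D + r \<and> set l \<subseteq> {1..\<Delta> + 1} \<and> foldr move_front l u = v \<and>
    spaced r l u"
  proof (cases "hd u = last v")
    case False
    let ?A = "{1..\<Delta> + 1} - {hd u}"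
    have "hd u \<in> {1..\<Delta> + 1}" using sub(1) ne(1) hd_in_set by blast
    then have "card ?A = \<Delta>" by simp
    then obtain w where w: "length w = r" "distinct w" "set w \<subseteq> ?A"
      "spaced r (v @ w) u"
      using ex_intermediate_word[of v u r r ?A] dist ne False assms by auto
    \<comment> \<open>Whatever word \<open>w\<close> has produced, moving the \<open>D\<close>
      letters of \<open>v\<close> replaces it entirely.\<close>
    have "foldr move_front (v @ w) u = v"
      using foldr_move_front_distinct[OF _ dist(2)] foldr_move_front[OF dist(1), of w] lens by simp
    then show ?thesis using w sub lens by (intro exI[of _ "v @ w"]) auto
  next
    case True
    let ?p = "butlast v"
    have v_eq: "v = ?p @ [hd u]" using True ne by simp
    have p: "distinct ?p" "hd u \<notin> set ?p" using dist(2) v_eq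
      by (metis distinct_butlast, metis distinct_append disjoint_insert(1) inf_commute list.set(2))
    have len: "length ?p = D - 1" using lens by simp
    \<comment> \<open>The bound \<open>D \<ge> 2 * r + 3\<close> is used in full here:
      \<open>w\<close> is drawn from only \<open>D - 1\<close> letters.\<close>
    then have "2 * r + 2 \<le> card (set ?p)" "?p \<noteq> []"
      using p(1) D by (auto simp: distinct_card simp flip: length_greater_0_conv)
    then obtain w where w: "length w = r + 1" "distinct w" "set w \<subseteq> set ?p"
      "spaced r (?p @ w) u"
      using ex_intermediate_word[of ?p u "r + 1" r "set ?p"] p dist ne \<open>2 * r + 2 \<le> card (set ?p)\<close>
      by blast
    let ?s = "foldr move_front w u"
    obtain t where t: "u = hd u # t" using ne by (cases u) auto
    have "hd u \<notin> set w" using w(3) p(2) by blast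
    \<comment> \<open>The letter \<open>hd u\<close> is never moved, so it stands right behind
      \<open>w\<close>; it survives the truncation because \<open>r + 1 < D\<close>.\<close>
    then have "w @ filter (\<lambda>y. y \<notin> set w) u = w @ hd u # filter (\<lambda>y. y \<notin> set w) t"
      by (subst t) simp
    moreover obtain m where m: "D - length w = Suc m" using w(1) D by (cases "D - length w") auto
    ultimately have s: "?s = w @ hd u # take m (filter (\<lambda>y. y \<notin> set w) t)"
      using foldr_move_front_distinct[OF dist(1) w(2)] lens w(1) D by simp
    have "distinct ?s" "length ?s = D" using foldr_move_front[OF dist(1), of w] lens by simp_all
    then have "foldr move_front (?p @ w) u = take D (?p @ filter (\<lambda>y. y \<notin> set ?p) ?s)"
      using foldr_move_front_distinct[OF _ p(1)] by simp
    \<comment> \<open>Every letter of \<open>w\<close> is moved again with \<open>?p\<close>, so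
      \<open>hd u\<close> comes to stand right behind \<open>?p\<close>, in the last place of the
      word.\<close>
    also have "filter (\<lambda>y. y \<notin> set ?p) w = []" using w(3) by (auto simp: filter_empty_conv)
    then have "filter (\<lambda>y. y \<notin> set ?p) ?s
        = hd u # filter (\<lambda>y. y \<notin> set ?p) (take m (filter (\<lambda>y. y \<notin> set w) t))"
      using p(2) by (simp add: s)
    also have "take D (?p @ \<dots>) = ?p @ [hd u]" using len D by (simp add: take_Cons')
    finally have "foldr move_front (?p @ w) u = v" using v_eq by simp
    moreover have "set ?p \<subseteq> {1..\<Delta> + 1}" using sub(2) by (auto dest: in_set_butlastD)
    ultimately show ?thesis using w len D by (intro exI[of _ "?p @ w"]) auto
  qed
  moreover have "r + 1 \<le> D" using D by simp
  ultimately show "\<exists>q. pre_digraph.awalk ?G u q v \<and> length q = D + r"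
    using foldr_move_front_walk[OF u] by metis
qed

theorem theorem3p2:
  fixes r D \<Delta> :: nat
  assumes "\<Delta> \<ge> D" and "D \<ge> 2 * r + 3"
  shows "vertex_symmetric (with_proj (Gamma \<Delta> D r)) \<and> k_reachable (with_proj (Gamma \<Delta> D r)) (D + r)"
  using vertex_symmetric_Gamma[of D \<Delta> r] k_reachable_Gamma[OF assms] assms by simp

end
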